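(* Let $M5$ be the real Lie algebra with basis $x_1,\dots,x_6$ and nonzero brackets $[x_1,x_3]=x_5$, $[x_1,x_4]=x_6$, $[x_2,x_3]=-x_6$, $[x_2,x_4]=x_5$. Any complex structure on $M5$ is equivalent either to the canonical complex structure $J_0$ or to some complex structure $J(\xi^1_3,\xi^1_4,\xi^5_5,\xi^6_5)$, with real parameters satisfying $\xi^1_4\,\xi^6_5\neq0$, where $J_0$ and $J(\xi^1_3,\xi^1_4,\xi^5_5,\xi^6_5)$ are the matrices given in the context.
   Context: Brackets of basis vectors not listed (and not obtained by antisymmetry) are zero. A complex structure on a real Lie algebra $\mathfrak{g}$ is a linear map $J:\mathfrak{g}\to\mathfrak{g}$ with $J^2=-1$ and $[JX,JY]-[X,Y]-J[JX,Y]-J[X,JY]=0$ for all $X,Y\in\mathfrak{g}$. $J$ is identified with its $6\times6$ matrix $(\xi^k_j)$ ($k$ row, $j$ column) in the basis $(x_j)$, i.e. $Jx_j=\sum_k\xi^k_jx_k$. Two complex structures $J_1,J_2$ are equivalent if $J_2=\Phi^{-1}J_1\Phi$ for some $\Phi\in\mathrm{Aut}(\mathfrak{g})$ (real Lie algebra automorphisms). $M5$ is the realification of the 3-dimensional complex Heisenberg Lie algebra $[Z_1,Z_2]=Z_3$ via $x_1=Z_1$, $x_2=-iZ_1$, $x_3=Z_2$, $x_4=iZ_2$, $x_5=Z_3$, $x_6=iZ_3$; the canonical complex structure $J_0$ is multiplication by $i$, i.e. $J_0=\mathrm{diag}\left(\begin{pmatrix} 0 & 1 \\ -1 & 0 \end{pmatrix},\begin{pmatrix}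 0 & -1 \\ 1 & 0 \end{pmatrix},\begin{pmatrix} 0 & -1 \\ 1 & 0 \end{pmatrix}\right)$. For real $\xi^1_3,\xi^1_4,\xi^5_5,\xi^6_5$ with $\xi^1_4\xi^6_5\ne0$, $$J(\xi^1_3,\xi^1_4,\xi^5_5,\xi^6_5)=\begin{pmatrix} a & -\xi^6_5\xi^1_4+\xi^6_5-\xi^5_5\xi^1_3 & \xi^1_3 & \xi^1_4 & 0 & 0 \\ 0 & 0 & 1 & 0 & 0 & 0 \\ 0 & -1 & 0 & 0 & 0 & 0 \\ b & c & d & -a & 0 & 0 \\ 0 & 0 & 0 & 0 & \xi^5_5 & -\frac{(\xi^5_5)^2+1}{\xi^6_5} \\ 0 & 0 & 0 & 0 & \xi^6_5 & -\xi^5_5 \end{pmatrix}$$ with $a=\frac{((\xi^5_5)^2+1)\xi^1_3+(\xi^1_4-1)\xi^6_5\xi^5_5}{\xi^6_5}$, $b=-\frac{1+a^2}{\xi^1_4}$, $d=\frac{1}{\xi^1_4}\left(\xi^6_5(\xi^1_4-1)+\xi^1_3(\xi^5_5-a)\right)$, $c=ad+(1+a^2)\frac{\xi^1_3}{\xi^1_4}$. *)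

theory Defs
  imports "HOL-Analysis.Analysis"
begin

definition lie_bracket :: "('a::real_vector \<Rightarrow> 'a \<Rightarrow> 'a) \<Rightarrow> bool" where
  "lie_bracket br \<longleftrightarrow> bilinear br \<and> (\<forall>X. br X X = 0) \<and>
     (\<forall>X Y Z. br X (br Y Z) + br Y (br Z X) + br Z (br X Y) = 0)"

definition lie_automorphism :: "('a::real_vector \<Rightarrow> 'a \<Rightarrow> 'a) \<Rightarrow> ('a \<Rightarrow> 'a) \<Rightarrow> bool" where
  "lie_automorphism br \<Phi> \<longleftrightarrow>
     linear \<Phi> \<and> bij \<Phi> \<and> (\<forall>X Y. \<Phi> (br X Y) = br (\<Phi> X) (\<Phi> Y))"

definition complex_structure :: "('a::real_vector \<Rightarrow> 'a \<Rightarrow> 'a) \<Rightarrow> ('a \<Rightarrow> 'a) \<Rightarrow> bool" where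
  "complex_structure br J \<longleftrightarrow>
     linear J \<and> (\<forall>X. J (J X) = - X) \<and>
     (\<forall>X Y. br (J X) (J Y) - br X Y - J (br (J X) Y) - J (br X (J Y)) = 0)"

definition equivalent_cs ::
  "('a::real_vector \<Rightarrow> 'a \<Rightarrow> 'a) \<Rightarrow> ('a \<Rightarrow> 'a) \<Rightarrow> ('a \<Rightarrow> 'a) \<Rightarrow> bool" where
  "equivalent_cs br J1 J2 \<longleftrightarrow>
     complex_structure br J1 \<and> complex_structure br J2 \<and>
     (\<exists>\<Phi>. lie_automorphism br \<Phi> \<and> J2 = inv \<Phi> \<circ> J1 \<circ> \<Phi>)"

text \<open>
  M5 is modelled on \<^typ>\<open>real^6\<close>, with the basis vector $x_j$ rendered as \<^term>\<open>axis j 1\<close>.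
  The indices are the numerals 1, ..., 6 of the index type, in which 6 and 0 denote the same
  element.
\<close>

definition m5_bracket :: "real^6 \<Rightarrow> real^6 \<Rightarrow> real^6" where
  "m5_bracket X Y = vector
     [0, 0, 0, 0,
      (X$1 * Y$3 - X$3 * Y$1) + (X$2 * Y$4 - X$4 * Y$2),
      (X$1 * Y$4 - X$4 * Y$1) - (X$2 * Y$3 - X$3 * Y$2)]"

definition m5_J0 :: "real^6^6" where
  "m5_J0 = vector
     [vector [ 0, 1, 0,  0, 0,  0],
      vector [-1, 0, 0,  0, 0,  0],
      vector [ 0, 0, 0, -1, 0,  0],
      vector [ 0, 0, 1,  0, 0,  0],
      vector [ 0, 0, 0,  0, 0, -1],
      vector [ 0, 0, 0,  0, 1,  0]]"

text \<open>The arguments \<open>p q r s\<close> are $\xi^1_3, \xi^1_4, \xi^5_5, \xi^6_5$, in this order.\<close>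

definition m5_J :: "real \<Rightarrow> real \<Rightarrow> real \<Rightarrow> real \<Rightarrow> real^6^6" where
  "m5_J p q r s =
     (let a = ((r\<^sup>2 + 1) * p + (q - 1) * s * r) / s;
          b = - ((1 + a\<^sup>2) / q);
          d = (1 / q) * (s * (q - 1) + p * (r - a));
          c = a * d + (1 + a\<^sup>2) * (p / q)
      in vector
        [vector [a, - s * q + s - r * p, p,   q, 0, 0],
         vector [0,                   0, 1,   0, 0, 0],
         vector [0,                  -1, 0,   0, 0, 0],
         vector [b,                   c, d, - a, 0, 0],
         vector [0,                   0, 0,   0, r, - ((r\<^sup>2 + 1) / s)],
         vector [0,                   0, 0,   0, s, - r]])"

lemma UNIV_6: "(UNIV :: 6 set) = {1, 2, 3, 4, 5, 6}"
proof -
  have "card {1::6, 2, 3, 4, 5, 6} = CARD(6)"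
    by simp
  then show ?thesis
    by (metis card_subset_eq finite_class.finite_UNIV top_greatest)
qed

lemma forall_6: "(\<forall>i::6. P i) \<longleftrightarrow> P 1 \<and> P 2 \<and> P 3 \<and> P 4 \<and> P 5 \<and> P 6"
  using UNIV_6 by (metis UNIV_I empty_iff insert_iff)

lemma sum_6: "sum f (UNIV :: 6 set) = f 1 + f 2 + f 3 + f 4 + f 5 + f 6"
  unfolding UNIV_6 by (simp add: add.assoc)

lemma vector_6 [simp]:
  "(vector [a, b, c, d, e, f] :: 'a::zero^6) $ 1 = a"
  "(vector [a, b, c, d, e, f] :: 'a^6) $ 2 = b"
  "(vector [a, b, c, d, e, f] :: 'a^6) $ 3 = c"
  "(vector [a, b, c, d, e, f] :: 'a^6) $ 4 = d"
  "(vector [a, b, c, d, e, f] :: 'a^6) $ 5 = e"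
  "(vector [a, b, c, d, e, f] :: 'a^6) $ 6 = f"
  by (simp_all add: vector_def)

lemma lie_bracket_m5: "lie_bracket m5_bracket"
  unfolding lie_bracket_def bilinear_def
  by (auto intro!: linearI simp: vec_eq_iff forall_6 m5_bracket_def algebra_simps)

lemma m5_bracket_basis:
  "m5_bracket (axis 1 1) (axis 3 1) = axis 5 1"
  "m5_bracket (axis 1 1) (axis 4 1) = axis 6 1"
  "m5_bracket (axis 2 1) (axis 3 1) = - axis 6 1"
  "m5_bracket (axis 2 1) (axis 4 1) = axis 5 1"
  "m5_bracket (axis 1 1) (axis 2 1) = 0"
  "m5_bracket (axis 3 1) (axis 4 1) = 0"
  "m5_bracket (axis 5 1) X = 0"
  "m5_bracket (axis 6 1) X = 0"
  by (simp_all add: vec_eq_iff forall_6 m5_bracket_def axis_def)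

text \<open>
  M5 as the realification of the complex Heisenberg algebra: the complex coordinates of \<open>X\<close> are
  those determined by $x_1 = Z_1$, $x_2 = -i Z_1$, $x_3 = Z_2$, $x_4 = i Z_2$, $x_5 = Z_3$,
  $x_6 = i Z_3$.
\<close>

definition m5_coords :: "real^6 \<Rightarrow> complex \<times> complex \<times> complex" where
  "m5_coords X = (Complex (X$1) (- X$2), Complex (X$3) (X$4), Complex (X$5) (X$6))"

lemma m5_coords_bracket:
  assumes "m5_coords X = (z1, z2, z3)" and "m5_coords Y = (w1, w2, w3)"
  shows "m5_coords (m5_bracket X Y) = (0, 0, z1 * w2 - z2 * w1)"
  using assms[symmetric] by (auto simp: m5_coords_def m5_bracket_def complex_eq_iff)

lemma m5_coords_J0:
  assumes "m5_coords X = (z1, z2, z3)"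
  shows "m5_coords (m5_J0 *v X) = (\<i> * z1, \<i> * z2, \<i> * z3)"
  using assms[symmetric]
  by (auto simp: m5_coords_def m5_J0_def matrix_vector_mult_def sum_6 complex_eq_iff)

lemma complex_structure_m5_J0: "complex_structure m5_bracket ((*v) m5_J0)"
  unfolding complex_structure_def
  by (auto simp: matrix_vector_mul_linear vec_eq_iff forall_6 m5_bracket_def m5_J0_def
      matrix_vector_mult_def sum_6 algebra_simps)

lemma complex_structure_m5_J:
  assumes "q * s \<noteq> 0"
  shows "complex_structure m5_bracket ((*v) (m5_J p q r s))"
proof -
  define a where "a = ((r\<^sup>2 + 1) * p + (q - 1) * s * r) / s"
  define t where "t = (r\<^sup>2 + 1) / s"
  define b where "b = - ((1 + a\<^sup>2) / q)"
  define d where "d = (1 / q) * (s * (q - 1) + p * (r - a))"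
  define c where "c = a * d + (1 + a\<^sup>2) * (p / q)"
  have nz: "q \<noteq> 0" "s \<noteq> 0"
    using assms by auto
  have a: "a = t * p + (q - 1) * r" and t: "t * s = r * r + 1"
    and b: "q * b = - 1 - a * a" and d: "q * d = s * q - s + p * r - p * a"
    using nz by (simp_all add: a_def t_def b_def d_def field_simps power2_eq_square)
  have c: "c = a * d - b * p"
    using nz by (simp add: c_def b_def field_simps power2_eq_square)
  have J: "(m5_J p q r s *v X) = vector
      [a * X$1 + (s - s * q - r * p) * X$2 + p * X$3 + q * X$4, X$3, - X$2,
       b * X$1 + c * X$2 + d * X$3 - a * X$4, r * X$5 - t * X$6, s * X$5 - r * X$6]" for X
    by (simp add: vec_eq_iff forall_6 m5_J_def Let_def matrix_vector_mult_def sum_6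
        a_def b_def c_def d_def t_def)
  define k where "k = s - s * q - r * p"
  have n12_5: "- a - (r*(-b-1) - t*c) = 0"
  proof -
    have "q * (- a - (r*(-b-1) - t*c)) = 0"
      using a t b d c k_def by algebra
    then show ?thesis using nz by simp
  qed
  have n13_5: "-b-1-(r*a-t*d) = 0"
  proof -
    have "q * (-b-1-(r*a-t*d)) = 0"
      using a t b d c k_def by algebra
    then show ?thesis using nz by simp
  qed
  have n23_5: "p-c-r*(k+d) = 0"
  proof -
    have "q * (p-c-r*(k+d)) = 0"
      using a t b d c k_def by algebra
    then show ?thesis using nz by simp
  qed
  have n24_5: "q-1-(-r*a-t*k) = 0"
  proof -
    have "q * (q-1-(-r*a-t*k)) = 0"
      using a t b d c k_def by algebra
    then show ?thesis using nz by simp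
  qed
  have n34_5: "-a-(r*(1-q)-t*p) = 0"
  proof -
    have "q * (-a-(r*(1-q)-t*p)) = 0"
      using a t b d c k_def by algebra
    then show ?thesis using nz by simp
  qed
  have n12_6: "a*c - b*k - (s*(-b-1) - r*c) = 0"
  proof -
    have "q * (a*c - b*k - (s*(-b-1) - r*c)) = 0"
      using a t b d c k_def by algebra
    then show ?thesis using nz by simp
  qed
  have n13_6: "a*d-b*p-(s*a-r*d) = 0"
  proof -
    have "q * (a*d-b*p-(s*a-r*d)) = 0"
      using a t b d c k_def by algebra
    then show ?thesis using nz by simp
  qed
  have n14_6: "-a*a-b*q-1 = 0"
  proof -
    have "q * (-a*a-b*q-1) = 0"
      using a t b d c k_def by algebra
    then show ?thesis using nz by simp
  qed
  have n23_6: "k*d-c*p-s*(k+d) = 0"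
  proof -
    have "q * (k*d-c*p-s*(k+d)) = 0"
      using a t b d c k_def by algebra
    then show ?thesis using nz by simp
  qed
  have n24_6: "-k*a-c*q-(-s*a-r*k) = 0"
  proof -
    have "q * (-k*a-c*q-(-s*a-r*k)) = 0"
      using a t b d c k_def by algebra
    then show ?thesis using nz by simp
  qed
  have n34_6: "-p*a-d*q-(s*(1-q)-r*p) = 0"
  proof -
    have "q * (-p*a-d*q-(s*(1-q)-r*p)) = 0"
      using a t b d c k_def by algebra
    then show ?thesis using nz by simp
  qed
  have c1: "a * a + q * b = - 1" and c2: "a * k - p + q * c = 0" and c3: "a * p + k + q * d = 0"
    using n14_6 n34_6 b d c k_def by algebra+
  have c5: "b * k - d - a * c = 0"
  proof -
    have "q * (b * k - d - a * c) = 0"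
      using c1 c2 c3 c by algebra
    then show ?thesis using nz by simp
  qed
  show ?thesis
    unfolding complex_structure_def
  proof (intro conjI allI)
    show "linear ((*v) (m5_J p q r s))"
      by (rule matrix_vector_mul_linear)
  next
    fix X :: "real^6"
    show "m5_J p q r s *v (m5_J p q r s *v X) = - X"
      unfolding J k_def[symmetric] vec_eq_iff forall_6 apply simp
      apply (intro conjI)
      using c1 c2 c3 c5 c t by algebra+
  next
    fix X Y :: "real^6"
    let ?J = "(*v) (m5_J p q r s)"
    let ?N = "m5_bracket (?J X) (?J Y) - m5_bracket X Y - ?J (m5_bracket (?J X) Y) - ?J (m5_bracket X (?J Y))"
    have "?N $ 5 = (X$1 * Y$2 - X$2 * Y$1) * (- a - (r*(-b-1) - t*c)) + (X$1 * Y$3 - X$3 * Y$1) * (-b-1-(r*a-t*d)) + (X$2 * Y$3 - X$3 * Y$2) * (p-c-r*(k+d)) + (X$2 * Y$4 - X$4 * Y$2) * (q-1-(-r*a-t*k)) + (X$3 * Y$4 - X$4 * Y$3) * (-a-(r*(1-q)-t*p))"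
      unfolding J k_def[symmetric] m5_bracket_def by simp algebra
    moreover have "?N $ 6 = (X$1 * Y$2 - X$2 * Y$1) * (a*c - b*k - (s*(-b-1) - r*c)) + (X$1 * Y$3 - X$3 * Y$1) * (a*d-b*p-(s*a-r*d)) + (X$1 * Y$4 - X$4 * Y$1) * (-a*a-b*q-1) + (X$2 * Y$3 - X$3 * Y$2) * (k*d-c*p-s*(k+d)) + (X$2 * Y$4 - X$4 * Y$2) * (-k*a-c*q-(-s*a-r*k)) + (X$3 * Y$4 - X$4 * Y$3) * (-p*a-d*q-(s*(1-q)-r*p))"
      unfolding J k_def[symmetric] m5_bracket_def by simp algebra
    moreover have "?N $ 1 = 0" "?N $ 2 = 0" "?N $ 3 = 0" "?N $ 4 = 0"
      unfolding J m5_bracket_def by simp_all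
    ultimately show "?N = 0"
      unfolding vec_eq_iff forall_6 n12_5 n13_5 n23_5 n24_5 n34_5 n12_6 n13_6 n14_6 n23_6 n24_6 n34_6 by simp
  qed
qed

end

theory Submission
  imports Defs
begin

text \<open>
  A complex structure \<open>J\<close> preserves the centre, so it induces a real endomorphism of the quotient by
  the centre, which is a complex plane with coordinates \<open>z1, z2\<close>. If this endomorphism is \<open>i\<close> or
  \<open>- i\<close>, then \<open>J\<close> is equivalent to \<open>J\<^sub>0\<close>, up to complex conjugation. Otherwise some real linear
  form \<open>\<alpha>\<close> and \<open>\<alpha> \<circ> J\<close> are complex independent, and a complex linear automorphism turns them into
  \<open>x\<^sup>2\<close> and \<open>x\<^sup>3\<close>. This fixes the second and third row of \<open>J\<close>; the remaining entries outside the
  lower left block are forced by integrability and \<open>J\<^sup>2 = - 1\<close>. The lower left block is irrelevant: if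
  \<open>J\<close> and \<open>K\<close> agree on the centre and modulo the centre, then \<open>(1 - K J) / 2\<close> is an automorphism
  intertwining them.
\<close>

section \<open>Automorphisms and equivalence of complex structures for an arbitrary bracket\<close>

lemma lie_automorphism_inv:
  assumes "lie_automorphism br \<Psi>"
  shows "lie_automorphism br (inv \<Psi>)"
proof -
  have lin: "linear \<Psi>" and bij: "bij \<Psi>" and hom: "\<And>X Y. \<Psi> (br X Y) = br (\<Psi> X) (\<Psi> Y)"
    using assms by (auto simp: lie_automorphism_def)
  have eq: "inv \<Psi> X = Y \<longleftrightarrow> X = \<Psi> Y" for X Y
    using bij by (metis bij_inv_eq_iff)
  have \<Psi>inv [simp]: "\<Psi> (inv \<Psi> X) = X" for X
    using bij by (simp add: bij_is_surj surj_f_inv_f)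
  have "linear (inv \<Psi>)"
    by (rule linearI) (simp_all add: eq linear_add[OF lin] linear_scale[OF lin])
  then show ?thesis
    using bij by (simp add: lie_automorphism_def bij_imp_bij_inv eq hom)
qed

lemma lie_automorphism_comp:
  assumes "lie_automorphism br \<Phi>" and "lie_automorphism br \<Psi>"
  shows "lie_automorphism br (\<Phi> \<circ> \<Psi>)"
  using assms by (auto simp: lie_automorphism_def intro: linear_compose bij_comp)

lemma equivalent_cs_trans:
  assumes "equivalent_cs br J1 J2" and "equivalent_cs br J2 J3"
  shows "equivalent_cs br J1 J3"
proof -
  obtain \<Phi> \<Psi> where aut: "lie_automorphism br \<Phi>" "lie_automorphism br \<Psi>"
    and eq: "J2 = inv \<Phi> \<circ> J1 \<circ> \<Phi>" "J3 = inv \<Psi> \<circ> J2 \<circ> \<Psi>"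
    using assms by (auto simp: equivalent_cs_def)
  have "inv (\<Phi> \<circ> \<Psi>) = inv \<Psi> \<circ> inv \<Phi>"
    using aut by (simp add: lie_automorphism_def o_inv_distrib)
  then have "J3 = inv (\<Phi> \<circ> \<Psi>) \<circ> J1 \<circ> (\<Phi> \<circ> \<Psi>)"
    using eq by (simp add: comp_assoc)
  then show ?thesis
    using assms lie_automorphism_comp[OF aut] by (auto simp: equivalent_cs_def)
qed

text \<open>The constructions below yield intertwiners from \<open>J\<close> to \<open>K\<close>;
  the automorphism that the definition of equivalence asks for is then
  \<open>inv \<Psi>\<close>.\<close>

lemma equivalent_cs_intertwine:
  assumes "complex_structure br J" and "complex_structure br K" and aut: "lie_automorphism br \<Psi>"
    and comm: "\<And>X. \<Psi> (J X) = K (\<Psi> X)"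
  shows "equivalent_cs br J K"
proof -
  have bij: "bij \<Psi>"
    using aut by (simp add: lie_automorphism_def)
  then have "K = inv (inv \<Psi>) \<circ> J \<circ> inv \<Psi>"
    by (simp add: fun_eq_iff inv_inv_eq comm bij_is_surj surj_f_inv_f)
  then show ?thesis
    using assms lie_automorphism_inv[OF aut] by (auto simp: equivalent_cs_def)
qed

lemma equivalent_cs_conjugate:
  assumes cs: "complex_structure br J" and aut: "lie_automorphism br \<Psi>"
  shows "equivalent_cs br J (\<Psi> \<circ> J \<circ> inv \<Psi>)"
proof (rule equivalent_cs_intertwine[OF cs _ aut])
  have lin: "linear \<Psi>" and bij: "bij \<Psi>" and hom: "\<And>X Y. \<Psi> (br X Y) = br (\<Psi> X) (\<Psi> Y)"
    using aut by (auto simp: lie_automorphism_def)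
  have linv: "linear (inv \<Psi>)" and hinv: "\<And>X Y. inv \<Psi> (br X Y) = br (inv \<Psi> X) (inv \<Psi> Y)"
    using lie_automorphism_inv[OF aut] by (auto simp: lie_automorphism_def)
  have inv_\<Psi> [simp]: "inv \<Psi> (\<Psi> X) = X" and \<Psi>_inv [simp]: "\<Psi> (inv \<Psi> X) = X" for X
    using bij by (simp_all add: bij_is_inj bij_is_surj surj_f_inv_f)
  have J: "linear J" "\<And>X. J (J X) = - X"
    and N: "\<And>X Y. br (J X) (J Y) - br X Y - J (br (J X) Y) - J (br X (J Y)) = 0"
    using cs by (auto simp: complex_structure_def)
  show "complex_structure br (\<Psi> \<circ> J \<circ> inv \<Psi>)"
    unfolding complex_structure_def
  proof (intro conjI allI)
    show "linear (\<Psi> \<circ> J \<circ> inv \<Psi>)"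
      by (intro linear_compose lin J linv)
  next
    fix X
    show "(\<Psi> \<circ> J \<circ> inv \<Psi>) ((\<Psi> \<circ> J \<circ> inv \<Psi>) X) = - X"
      by (simp add: J linear_neg[OF lin])
  next
    fix X Y
    let ?K = "\<Psi> \<circ> J \<circ> inv \<Psi>" and ?X = "inv \<Psi> X" and ?Y = "inv \<Psi> Y"
    have "br (?K X) (?K Y) - br X Y - ?K (br (?K X) Y) - ?K (br X (?K Y)) =
        \<Psi> (br (J ?X) (J ?Y) - br ?X ?Y - J (br (J ?X) ?Y) - J (br ?X (J ?Y)))"
      by (simp add: linear_diff[OF lin] hom hinv)
    then show "br (?K X) (?K Y) - br X Y - ?K (br (?K X) Y) - ?K (br X (?K Y)) = 0"
      by (simp add: N linear_0[OF lin])
  qed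
  show "\<Psi> (J X) = (\<Psi> \<circ> J \<circ> inv \<Psi>) (\<Psi> X)" for X
    by simp
qed

section \<open>The centre of M5\<close>

definition m5_center :: "(real^6) set" where
  "m5_center = {X. X$1 = 0 \<and> X$2 = 0 \<and> X$3 = 0 \<and> X$4 = 0}"

lemma m5_bracket_center [simp]: "m5_bracket X Y \<in> m5_center"
  by (simp add: m5_center_def m5_bracket_def)

text \<open>In complex coordinates, bracketing with \<open>U\<close> is the complex linear form
  \<open>z1 * w2 - z2 * w1\<close> in \<open>(w1, w2)\<close>. It is onto unless
  \<open>z1 = z2 = 0\<close>, that is, unless \<open>U\<close> is central.\<close>

lemma m5_bracket_onto_center:
  assumes "U \<notin> m5_center" and "Z \<in> m5_center"
  obtains Y where "m5_bracket U Y = Z"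
proof -
  define z1 z2 z3 where "z1 = Complex (U$1) (- U$2)" and "z2 = Complex (U$3) (U$4)"
    and "z3 = Complex (Z$5) (Z$6)"
  have "z1 \<noteq> 0 \<or> z2 \<noteq> 0"
    using assms(1) by (auto simp: z1_def z2_def m5_center_def complex_eq_iff)
  then obtain w1 w2 where w: "z1 * w2 - z2 * w1 = z3"
  proof
    assume "z1 \<noteq> 0"
    then show thesis by (intro that[of "z3 / z1" 0]) simp
  next
    assume "z2 \<noteq> 0"
    then show thesis by (intro that[of 0 "- z3 / z2"]) simp
  qed
  define Y :: "real^6" where "Y = vector [Re w1, - Im w1, Re w2, Im w2, 0, 0]"
  have "m5_coords (m5_bracket U Y) = (0, 0, z1 * w2 - z2 * w1)"
    by (rule m5_coords_bracket[where ?z3.0 = "Complex (U$5) (U$6)" and ?w3.0 = 0])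
      (auto simp: m5_coords_def z1_def z2_def Y_def complex_eq_iff)
  then have "m5_bracket U Y = Z"
    using assms(2) unfolding w z3_def
    by (auto simp: m5_coords_def m5_center_def vec_eq_iff forall_6 complex_eq_iff)
  then show thesis ..
qed

text \<open>
  For central \<open>X\<close> and \<open>U = J X\<close>, integrability reads \<open>[U, J Y] = J [U, Y]\<close>. If \<open>U\<close> is not
  central, \<open>[U, Y]\<close> fills the whole centre, so that \<open>J\<close> preserves the centre after all.
\<close>
lemma complex_structure_center:
  assumes cs: "complex_structure m5_bracket J" and X: "X \<in> m5_center"
  shows "J X \<in> m5_center"
proof (rule ccontr)
  assume "J X \<notin> m5_center"
  then obtain Y where Y: "m5_bracket (J X) Y = X"
    using X by (rule m5_bracket_onto_center)
  have "m5_bracket X Y' = 0" for Y'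
    using X by (simp add: m5_center_def m5_bracket_def vec_eq_iff forall_6)
  moreover have "linear J"
    and "m5_bracket (J X) (J Y) - m5_bracket X Y - J (m5_bracket (J X) Y) - J (m5_bracket X (J Y)) = 0"
    using cs by (auto simp: complex_structure_def)
  ultimately have "J X = m5_bracket (J X) (J Y)"
    by (simp add: Y linear_0)
  then show False
    using \<open>J X \<notin> m5_center\<close> by (metis m5_bracket_center)
qed

text \<open>Brackets are central and depend only on classes modulo the centre, so a linear bijection
  that is the identity on the centre and modulo it preserves brackets. For \<Psi> = (1 - K J) / 2,
  both \<Psi> J and K \<Psi> equal (J + K) / 2, as J and K square to -1.\<close>

lemma equivalent_cs_modulo_center:
  assumes J: "complex_structure m5_bracket J" and K: "complex_structure m5_bracket K"
    and quot: "\<And>X. J X - K X \<in> m5_center" and cent: "\<And>X. X \<in> m5_center \<Longrightarrow> J X = K X"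
  shows "equivalent_cs m5_bracket J K"
proof (rule equivalent_cs_intertwine[OF J K])
  define \<Psi> where "\<Psi> X = (1/2) *\<^sub>R (X - K (J X))" for X
  have lin: "linear J" "linear K" and sq: "J (J X) = - X" "K (K X) = - X" for X
    using J K by (auto simp: complex_structure_def)
  show "\<Psi> (J X) = K (\<Psi> X)" for X
    by (simp add: \<Psi>_def sq linear_scale[OF lin(2)] linear_diff[OF lin(2)] linear_neg[OF lin(2)])
  have lin\<Psi>: "linear \<Psi>"
    by (rule linearI) (simp_all add: \<Psi>_def linear_add[OF lin(1)] linear_add[OF lin(2)]
        linear_scale[OF lin(1)] linear_scale[OF lin(2)] algebra_simps flip: scaleR_add_right scaleR_diff_right)
  have \<Psi>_cent: "\<Psi> X = X" if "X \<in> m5_center" for X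
    using cent[OF that] by (simp add: \<Psi>_def sq flip: scaleR_2)
  \<comment> \<open>The vector is \<open>K (J X - K X)\<close>, and \<open>K\<close> preserves the
    centre.\<close>
  have "K (J X) + X \<in> m5_center" for X
    using complex_structure_center[OF K quot[of X]]
    by (simp add: linear_diff[OF lin(2)] sq)
  then have \<Psi>_quot: "\<Psi> X $ i = X $ i" if "i \<in> {1,2,3,4}" for X i
    using that by (auto simp: \<Psi>_def m5_center_def eq_neg_iff_add_eq_0[symmetric] add_eq_0_iff2)
  have "inj \<Psi>"
  proof (subst linear_injective_0[OF lin\<Psi>], intro allI impI)
    fix X assume "\<Psi> X = 0"
    then have "X \<in> m5_center"
      using \<Psi>_quot[of 1 X] \<Psi>_quot[of 2 X] \<Psi>_quot[of 3 X] \<Psi>_quot[of 4 X] by (simp add: m5_center_def)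
    then show "X = 0"
      using \<Psi>_cent \<open>\<Psi> X = 0\<close> by metis
  qed
  then have "bij \<Psi>"
    using lin\<Psi> by (simp add: bij_def linear_injective_imp_surjective)
  moreover have "m5_bracket (\<Psi> X) (\<Psi> Y) = m5_bracket X Y" for X Y
    by (simp add: m5_bracket_def \<Psi>_quot)
  ultimately show "lie_automorphism m5_bracket \<Psi>"
    using lin\<Psi> \<Psi>_cent by (simp add: lie_automorphism_def)
qed

section \<open>Two kinds of automorphisms of M5\<close>

text \<open>The bracket is a 2 by 2 determinant in \<open>z1, z2\<close>, so a complex linear change
  of these coordinates multiplies it by its own determinant; hence the factor on
  \<open>z3\<close>.\<close>

lemma m5_complex_linear_automorphism:
  assumes "a1 * b2 - a2 * b1 \<noteq> 0"
  obtains \<Psi> where "lie_automorphism m5_bracket \<Psi>"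
    and "\<And>X z1 z2 z3. m5_coords X = (z1, z2, z3) \<Longrightarrow>
      m5_coords (\<Psi> X) = (a1 * z1 + a2 * z2, b1 * z1 + b2 * z2, (a1 * b2 - a2 * b1) * z3)"
proof -
  define \<delta> where "\<delta> = a1 * b2 - a2 * b1"
  define \<Psi> :: "real^6 \<Rightarrow> real^6" where "\<Psi> X =
    (let z1 = Complex (X$1) (- X$2); z2 = Complex (X$3) (X$4); z3 = Complex (X$5) (X$6);
         u = a1 * z1 + a2 * z2; v = b1 * z1 + b2 * z2; w = \<delta> * z3
     in vector [Re u, - Im u, Re v, Im v, Re w, Im w])" for X
  have coords: "m5_coords (\<Psi> X) = (a1 * z1 + a2 * z2, b1 * z1 + b2 * z2, \<delta> * z3)"
    if "m5_coords X = (z1, z2, z3)" for X z1 z2 z3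
    using that by (auto simp: m5_coords_def \<Psi>_def Let_def complex_eq_iff)
  have coords_inj: "X = Y" if "m5_coords X = m5_coords Y" for X Y
    using that by (simp add: m5_coords_def vec_eq_iff forall_6)
  have lin: "linear \<Psi>"
    by (rule linearI) (simp_all add: \<Psi>_def Let_def vec_eq_iff forall_6 algebra_simps)
  have "inj \<Psi>"
  proof (subst linear_injective_0[OF lin], intro allI impI)
    fix X assume "\<Psi> X = 0"
    obtain z1 z2 z3 where z: "m5_coords X = (z1, z2, z3)"
      by (metis prod_cases3)
    have "a1 * z1 + a2 * z2 = 0" "b1 * z1 + b2 * z2 = 0" "\<delta> * z3 = 0"
      using coords[OF z] \<open>\<Psi> X = 0\<close> by (auto simp: m5_coords_def complex_eq_iff)
    moreover from this have "\<delta> * z1 = 0" "\<delta> * z2 = 0"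
      unfolding \<delta>_def by algebra+
    ultimately have "z1 = 0" "z2 = 0" "z3 = 0"
      using assms by (simp_all add: \<delta>_def)
    then show "X = 0"
      using z by (simp add: m5_coords_def vec_eq_iff forall_6 complex_eq_iff)
  qed
  then have "bij \<Psi>"
    using lin by (simp add: bij_def linear_injective_imp_surjective)
  moreover have "\<Psi> (m5_bracket X Y) = m5_bracket (\<Psi> X) (\<Psi> Y)" for X Y
  proof (rule coords_inj)
    obtain z1 z2 z3 where z: "m5_coords X = (z1, z2, z3)"
      by (metis prod_cases3)
    obtain w1 w2 w3 where w: "m5_coords Y = (w1, w2, w3)"
      by (metis prod_cases3)
    show "m5_coords (\<Psi> (m5_bracket X Y)) = m5_coords (m5_bracket (\<Psi> X) (\<Psi> Y))"
      unfolding coords[OF m5_coords_bracket[OF z w]] m5_coords_bracket[OF coords[OF z] coords[OF w]]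
      by (simp add: \<delta>_def algebra_simps)
  qed
  ultimately show thesis
    using that[of \<Psi>] lin coords by (simp add: lie_automorphism_def \<delta>_def)
qed

text \<open>Complex conjugation of all three coordinates of \<open>m5_coords\<close>; conjugating by
  it exchanges J0 and -J0.\<close>

definition m5_conj :: "real^6 \<Rightarrow> real^6" where
  "m5_conj X = vector [X$1, - X$2, X$3, - X$4, X$5, - X$6]"

lemma m5_conj_automorphism: "lie_automorphism m5_bracket m5_conj"
proof -
  have "m5_conj (m5_conj X) = X" for X
    by (simp add: m5_conj_def vec_eq_iff forall_6)
  then have "bij m5_conj"
    by (intro o_bij[of m5_conj]) (simp_all add: fun_eq_iff)
  moreover have "linear m5_conj"
    by (rule linearI) (simp_all add: m5_conj_def vec_eq_iff forall_6)
  moreover have "m5_conj (m5_bracket X Y) = m5_bracket (m5_conj X) (m5_conj Y)" for X Y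
    by (simp add: m5_conj_def m5_bracket_def vec_eq_iff forall_6)
  ultimately show ?thesis
    by (simp add: lie_automorphism_def)
qed

section \<open>Reduction to the two normal forms\<close>

lemma complex_structure_matrix:
  fixes J :: "real^6 \<Rightarrow> real^6"
  assumes cs: "complex_structure m5_bracket J"
  obtains A :: "real^6^6" where "J = (*v) A"
    and "\<And>k. k \<in> {1,2,3,4} \<Longrightarrow> A$k$5 = 0" and "\<And>k. k \<in> {1,2,3,4} \<Longrightarrow> A$k$6 = 0"
proof -
  have "linear J"
    using cs by (simp add: complex_structure_def)
  then have J: "J = (*v) (matrix J)"
    by (simp add: fun_eq_iff matrix_works)
  have "axis 5 1 \<in> m5_center" "axis 6 1 \<in> m5_center"
    by (simp_all add: m5_center_def axis_def)
  then have "J (axis 5 1) \<in> m5_center" "J (axis 6 1) \<in> m5_center"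
    using complex_structure_center[OF cs] by auto
  then show thesis
    by (intro that[OF J]) (auto simp: matrix_def m5_center_def)
qed

text \<open>Once rows 2 and 3 are fixed, \<open>J\<^sup>2 = - 1\<close> and integrability on the
  single pair x3, x4 determine the upper left and the central block from \<open>p, q, r, s\<close>.
  The lower left block is absorbed by \<open>equivalent_cs_modulo_center\<close>.\<close>

lemma equivalent_cs_m5_J:
  assumes cs: "complex_structure m5_bracket J"
    and row2: "\<And>X. J X $ 2 = X $ 3" and row3: "\<And>X. J X $ 3 = - X $ 2"
  shows "\<exists>p q r s. q * s \<noteq> 0 \<and> equivalent_cs m5_bracket J ((*v) (m5_J p q r s))"
proof -
  obtain A where A: "J = (*v) A" and "\<And>k. k \<in> {1,2,3,4} \<Longrightarrow> A$k$5 = 0"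
    and "\<And>k. k \<in> {1,2,3,4} \<Longrightarrow> A$k$6 = 0"
    using complex_structure_matrix[OF cs] by metis
  then have A56: "A$1$5 = 0" "A$2$5 = 0" "A$3$5 = 0" "A$4$5 = 0"
    "A$1$6 = 0" "A$2$6 = 0" "A$3$6 = 0" "A$4$6 = 0"
    by simp_all
  have Jk: "J X $ k = A$k$1 * X$1 + A$k$2 * X$2 + A$k$3 * X$3 + A$k$4 * X$4 + A$k$5 * X$5 + A$k$6 * X$6"
    for X k
    by (simp add: A matrix_vector_mult_def sum_6)
  have A23: "A$2$1 = 0" "A$2$2 = 0" "A$2$3 = 1" "A$2$4 = 0"
    "A$3$1 = 0" "A$3$2 = -1" "A$3$3 = 0" "A$3$4 = 0"
    using row2[of "axis 1 1"] row2[of "axis 2 1"] row2[of "axis 3 1"] row2[of "axis 4 1"]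
      row3[of "axis 1 1"] row3[of "axis 2 1"] row3[of "axis 3 1"] row3[of "axis 4 1"]
    by (simp_all add: Jk axis_def)
  define a k p q where "a = A$1$1" and "k = A$1$2" and "p = A$1$3" and "q = A$1$4"
  define b c d e where "b = A$4$1" and "c = A$4$2" and "d = A$4$3" and "e = A$4$4"
  define r t s r' where "r = A$5$5" and "t = - A$5$6" and "s = A$6$5" and "r' = A$6$6"
  note entries = a_def[symmetric] k_def[symmetric] p_def[symmetric] q_def[symmetric]
    b_def[symmetric] c_def[symmetric] d_def[symmetric] e_def[symmetric]
    r_def[symmetric] s_def[symmetric] r'_def[symmetric] t_def
  have sq: "J (J X) $ i = - X $ i" for X i
    using cs by (simp add: complex_structure_def)
  have N: "(m5_bracket (J X) (J Y) - m5_bracket X Y - J (m5_bracket (J X) Y)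
      - J (m5_bracket X (J Y))) $ i = 0" for X Y i
    using cs by (simp add: complex_structure_def)
  have q1: "a * a + q * b = -1" and q2: "a * k - p + q * c = 0" and q3: "a * p + k + q * d = 0"
    and q4: "q * (a + e) = 0"
    using sq[of "axis 1 1" 1] sq[of "axis 2 1" 1] sq[of "axis 3 1" 1] sq[of "axis 4 1" 1]
    by (simp_all add: Jk A56 A23 axis_def entries algebra_simps)
  have z1: "r * r - t * s = -1" and z2: "s * (r + r') = 0"
    using sq[of "axis 5 1" 5] sq[of "axis 5 1" 6]
    by (simp_all add: Jk A56 A23 axis_def entries algebra_simps)
  \<comment> \<open>If \<open>q\<close> or \<open>s\<close> vanished, \<open>q1\<close> or
    \<open>z1\<close> would make a real square equal to -1.\<close>
  have nz: "q \<noteq> 0" "s \<noteq> 0"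
    using q1 z1 by (auto simp: add_eq_0_iff) (smt (verit) zero_le_square)+
  have e: "e = - a" and r': "r' = - r"
    using q4 z2 nz by auto
  have n1: "- a - (r * (1 - q) - t * p) = 0" and n2: "- p * a - d * q - (s * (1 - q) - r * p) = 0"
    using N[of "axis 3 1" "axis 4 1" 5] N[of "axis 3 1" "axis 4 1" 6]
    by (simp_all add: Jk A56 A23 axis_def entries e r' m5_bracket_def algebra_simps)
  have t: "t = (r\<^sup>2 + 1) / s"
    using z1 nz by (simp add: field_simps power2_eq_square)
  have a: "a = ((r\<^sup>2 + 1) * p + (q - 1) * s * r) / s"
    using n1 nz t by (simp add: field_simps)
  have b: "b = - ((1 + a\<^sup>2) / q)"
    using q1 nz by (simp add: field_simps power2_eq_square)
  have k: "k = - s * q + s - r * p"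
    using n2 q3 by (simp add: algebra_simps)
  have d: "d = (1 / q) * (s * (q - 1) + p * (r - a))"
    using n2 nz by (simp add: field_simps)
  have c: "c = a * d + (1 + a\<^sup>2) * (p / q)"
  proof -
    have "q * c = q * (a * d + (1 + a\<^sup>2) * (p / q))"
      using q2 q3 nz by (simp add: distrib_left power2_eq_square) algebra
    then show ?thesis
      using nz by simp
  qed
  define K where "K = (*v) (m5_J p q r s)"
  have Kv: "K X = vector [a * X$1 + k * X$2 + p * X$3 + q * X$4, X$3, - X$2,
      b * X$1 + c * X$2 + d * X$3 - a * X$4, r * X$5 - t * X$6, s * X$5 - r * X$6]" for X
    unfolding K_def m5_J_def Let_def a[symmetric] b[symmetric] d[symmetric] c[symmetric]
      k[symmetric] t[symmetric]
    by (simp add: vec_eq_iff forall_6 matrix_vector_mult_def sum_6)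
  have qs: "q * s \<noteq> 0"
    using nz by simp
  have "equivalent_cs m5_bracket J K"
  proof (rule equivalent_cs_modulo_center[OF cs])
    show "complex_structure m5_bracket K"
      unfolding K_def by (rule complex_structure_m5_J[OF qs])
    show "J X - K X \<in> m5_center" for X
      by (simp add: m5_center_def Kv Jk A56 A23 entries e)
    show "J X = K X" if "X \<in> m5_center" for X
      using that by (simp add: m5_center_def Kv Jk A56 A23 entries r' vec_eq_iff forall_6)
  qed
  then show ?thesis
    using qs unfolding K_def by blast
qed

text \<open>It remains to see that \<open>J\<close> is J0 on the centre. The bracket is complex
  bilinear and ignores central parts, so for \<open>Z = [X, Y]\<close> integrability becomes -2 Z -
  2 J (J0 Z) = 0; applying \<open>J\<close> gives J Z = J0 Z.\<close>

lemma equivalent_cs_m5_J0: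
  assumes cs: "complex_structure m5_bracket J" and quot: "\<And>X. J X - m5_J0 *v X \<in> m5_center"
  shows "equivalent_cs m5_bracket J ((*v) m5_J0)"
proof (rule equivalent_cs_modulo_center[OF cs complex_structure_m5_J0 quot])
  have Jk: "J X $ 1 = X $ 2" "J X $ 2 = - X $ 1" "J X $ 3 = - X $ 4" "J X $ 4 = X $ 3" for X
    using quot[of X]
    by (simp_all add: m5_center_def m5_J0_def matrix_vector_mult_def sum_6)
  fix Z assume "Z \<in> m5_center"
  have "(axis 1 1 :: real^6) \<notin> m5_center"
    by (simp add: m5_center_def axis_def)
  then obtain Y where Z: "Z = m5_bracket (axis 1 1) Y"
    using \<open>Z \<in> m5_center\<close> m5_bracket_onto_center by metis
  let ?X = "axis 1 1 :: real^6"
  have lin: "linear J" and sq: "J (J X) = - X"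
    and N: "m5_bracket (J X) (J Y) - m5_bracket X Y - J (m5_bracket (J X) Y) - J (m5_bracket X (J Y)) = 0"
    for X Y
    using cs by (auto simp: complex_structure_def)
  have J0: "m5_bracket (J X) Y = m5_J0 *v m5_bracket X Y" "m5_bracket X (J Y) = m5_J0 *v m5_bracket X Y"
    for X Y
    by (simp_all add: m5_bracket_def m5_J0_def Jk matrix_vector_mult_def sum_6 vec_eq_iff forall_6)
  have J0sq: "m5_J0 *v (m5_J0 *v X) = - X" for X
    using complex_structure_m5_J0 by (simp add: complex_structure_def)
  have "- Z - Z - J (m5_J0 *v Z) - J (m5_J0 *v Z) = 0"
    using N[of ?X Y] unfolding J0 J0sq Z[symmetric] .
  then have "J (m5_J0 *v Z) = - Z"
    by (auto simp: vec_eq_iff minus_equation_iff)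
  then have "J (J (m5_J0 *v Z)) = - J Z"
    by (simp add: linear_neg[OF lin])
  then show "J Z = m5_J0 *v Z"
    by (simp add: sq)
qed

section \<open>Three cases for the action of a complex structure modulo the centre\<close>

text \<open>
  Let \<open>\<alpha> = \<Sum>k\<le>4. v\<^sub>k x\<^sup>k\<close>, \<open>\<beta> = \<alpha> \<circ> J = \<Sum>k\<le>4. w\<^sub>k x\<^sup>k\<close> and write \<open>\<alpha> = - Im A\<close>, \<open>\<beta> = Re B\<close>
  with complex linear forms \<open>A = a1 z1 + a2 z2\<close>, \<open>B = b1 z1 + b2 z2\<close>. If \<open>A\<close> and \<open>B\<close> are always
  dependent, then \<open>J\<close> preserves every complex line of linear forms and so is a complex scalar.
\<close>
lemma complex_structure_m5_cases [consumes 1, case_names scalar conj_scalar generic]: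
  assumes cs: "complex_structure m5_bracket J"
  obtains (scalar) "\<And>X. J X - m5_J0 *v X \<in> m5_center"
  | (conj_scalar) "\<And>X. J X + m5_J0 *v X \<in> m5_center"
  | (generic) a1 a2 b1 b2 where "a1 * b2 - a2 * b1 \<noteq> 0"
    and "\<And>X z1 z2 z3 w1 w2 w3. m5_coords X = (z1, z2, z3) \<Longrightarrow> m5_coords (J X) = (w1, w2, w3) \<Longrightarrow>
      - Im (a1 * w1 + a2 * w2) = Re (b1 * z1 + b2 * z2)"
proof -
  obtain A where A: "J = (*v) A" and "\<And>k. k \<in> {1,2,3,4} \<Longrightarrow> A$k$5 = 0"
    and "\<And>k. k \<in> {1,2,3,4} \<Longrightarrow> A$k$6 = 0"
    using complex_structure_matrix[OF cs] by metis
  then have A56: "A$1$5 = 0" "A$2$5 = 0" "A$3$5 = 0" "A$4$5 = 0"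
    "A$1$6 = 0" "A$2$6 = 0" "A$3$6 = 0" "A$4$6 = 0"
    by simp_all
  have Jk: "J X $ k = A$k$1 * X$1 + A$k$2 * X$2 + A$k$3 * X$3 + A$k$4 * X$4 + A$k$5 * X$5 + A$k$6 * X$6"
    for X k
    by (simp add: A matrix_vector_mult_def sum_6)
  define w where "w v1 v2 v3 v4 l = v1 * A$1$l + v2 * A$2$l + v3 * A$3$l + v4 * A$4$l" for v1 v2 v3 v4 l
  \<comment> \<open>This is \<open>a1 * b2 - a2 * b1\<close>, with the coefficients of the complex
    forms read off from \<open>\<alpha> = - Im A\<close> and \<open>\<beta> = Re B\<close>, where
    \<open>z1\<close> is x1 - i x2 and \<open>z2\<close> is x3 + i x4.\<close>
  define Q where "Q v1 v2 v3 v4 =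
    (let w = w v1 v2 v3 v4 in
      Complex v2 (- v1) * Complex (w 3) (- w 4) - Complex (- v4) (- v3) * Complex (w 1) (w 2))"
    for v1 v2 v3 v4
  show thesis
  proof (cases "\<exists>v1 v2 v3 v4. Q v1 v2 v3 v4 \<noteq> 0")
    case True
    then obtain v1 v2 v3 v4 where "Q v1 v2 v3 v4 \<noteq> 0"
      by blast
    then show thesis
      unfolding Q_def Let_def
    proof (rule generic)
      fix X z1 z2 z3 w1 w2 w3
      assume "m5_coords X = (z1, z2, z3)" and "m5_coords (J X) = (w1, w2, w3)"
      then show "- Im (Complex v2 (- v1) * w1 + Complex (- v4) (- v3) * w2) =
          Re (Complex (w v1 v2 v3 v4 1) (w v1 v2 v3 v4 2) * z1 + Complex (w v1 v2 v3 v4 3) (- w v1 v2 v3 v4 4) * z2)"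
        by (auto simp: m5_coords_def w_def Jk A56 algebra_simps)
    qed
  next
    case False
    define Qr where "Qr v1 v2 v3 v4 =
      v2 * w v1 v2 v3 v4 3 - v1 * w v1 v2 v3 v4 4 + v4 * w v1 v2 v3 v4 1 - v3 * w v1 v2 v3 v4 2" for v1 v2 v3 v4
    define Qi where "Qi v1 v2 v3 v4 =
      - v2 * w v1 v2 v3 v4 4 - v1 * w v1 v2 v3 v4 3 + v4 * w v1 v2 v3 v4 2 + v3 * w v1 v2 v3 v4 1" for v1 v2 v3 v4
    have Q: "Qr v1 v2 v3 v4 = 0" "Qi v1 v2 v3 v4 = 0" for v1 v2 v3 v4
      using False by (auto simp: Qr_def Qi_def Q_def Let_def complex_eq_iff algebra_simps)
    \<comment> \<open>The real and imaginary parts of \<open>Q\<close> are quadratic forms in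
      \<open>v\<close>, so unit vectors and sums of two of them detect all coefficients.\<close>
    note Q_eqs = Q[of 1 0 0 0] Q[of 0 1 0 0] Q[of 0 0 1 0] Q[of 0 0 0 1]
      Q[of 1 1 0 0] Q[of 1 0 1 0] Q[of 1 0 0 1] Q[of 0 1 1 0] Q[of 0 1 0 1] Q[of 0 0 1 1]
    \<comment> \<open>Modulo the centre, \<open>J\<close> turns out to be multiplication by the
      complex number \<sigma> + i \<tau>, whose square must be -1.\<close>
    define \<sigma> \<tau> where "\<sigma> = A$1$1" and "\<tau> = A$1$2"
    have ent: "A$1$3 = 0" "A$1$4 = 0" "A$2$3 = 0" "A$2$4 = 0"
      "A$3$1 = 0" "A$3$2 = 0" "A$4$1 = 0" "A$4$2 = 0"
      "A$1$1 = \<sigma>" "A$2$2 = \<sigma>" "A$3$3 = \<sigma>" "A$4$4 = \<sigma>"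
      "A$1$2 = \<tau>" "A$2$1 = - \<tau>" "A$3$4 = - \<tau>" "A$4$3 = \<tau>"
      using Q_eqs by (simp_all add: Qr_def Qi_def w_def \<sigma>_def \<tau>_def)
    have sq: "J (J X) $ i = - X $ i" for X i
      using cs by (simp add: complex_structure_def)
    have 1: "\<sigma> * \<sigma> - \<tau> * \<tau> = -1" "\<sigma> * \<tau> = 0"
      using sq[of "axis 1 1" 1] sq[of "axis 1 1" 2]
      by (simp_all add: Jk A56 ent axis_def)
    have "\<tau> \<noteq> 0"
      using 1 by (smt (verit) zero_le_square mult_eq_0_iff)
    then have "\<sigma> = 0" "\<tau> * \<tau> = 1"
      using 1 by auto
    then have "\<sigma> = 0" "\<tau> = 1 \<or> \<tau> = - 1"
      by (auto simp: square_eq_1_iff)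
    then show thesis
      using scalar conj_scalar
      by (auto simp: m5_center_def Jk A56 ent m5_J0_def matrix_vector_mult_def sum_6)
  qed
qed

theorem theorem1:
  fixes J :: "real^6 \<Rightarrow> real^6"
  assumes "complex_structure m5_bracket J"
  shows "equivalent_cs m5_bracket J ((*v) m5_J0) \<or>
    (\<exists>\<xi>13 \<xi>14 \<xi>55 \<xi>65 :: real. \<xi>14 * \<xi>65 \<noteq> 0 \<and>
      equivalent_cs m5_bracket J ((*v) (m5_J \<xi>13 \<xi>14 \<xi>55 \<xi>65)))"
  using assms
proof (cases rule: complex_structure_m5_cases)
  case scalar
  then show ?thesis
    using equivalent_cs_m5_J0[OF assms] by blast
next
  case conj_scalar
  have eq: "equivalent_cs m5_bracket J (m5_conj \<circ> J \<circ> inv m5_conj)" (is "equivalent_cs _ _ ?K")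
    by (rule equivalent_cs_conjugate[OF assms m5_conj_automorphism])
  have "m5_conj (m5_conj X) = X" for X
    by (simp add: m5_conj_def vec_eq_iff forall_6)
  then have "inv m5_conj = m5_conj"
    by (metis inv_equality)
  moreover have "m5_conj (J (m5_conj X)) - m5_J0 *v X \<in> m5_center" for X
    using conj_scalar[of "m5_conj X"]
    by (auto simp: m5_center_def m5_conj_def m5_J0_def matrix_vector_mult_def sum_6)
  ultimately have "equivalent_cs m5_bracket ?K ((*v) m5_J0)"
    using eq by (intro equivalent_cs_m5_J0) (simp_all add: equivalent_cs_def)
  then show ?thesis
    using equivalent_cs_trans[OF eq] by blast
next
  case (generic a1 a2 b1 b2)
  obtain \<Psi> where aut: "lie_automorphism m5_bracket \<Psi>"
    and coords: "\<And>X z1 z2 z3. m5_coords X = (z1, z2, z3) \<Longrightarrow>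
      m5_coords (\<Psi> X) = (a1 * z1 + a2 * z2, b1 * z1 + b2 * z2, (a1 * b2 - a2 * b1) * z3)"
    using m5_complex_linear_automorphism[OF generic(1)] by blast
  have eq: "equivalent_cs m5_bracket J (\<Psi> \<circ> J \<circ> inv \<Psi>)" (is "equivalent_cs _ _ ?K")
    by (rule equivalent_cs_conjugate[OF assms aut])
  \<comment> \<open>The second real coordinate is minus the imaginary part of the first complex one,
    and the third is the real part of the second, so this is the generic relation.\<close>
  have \<Psi>: "\<Psi> (J X) $ 2 = \<Psi> X $ 3" for X
  proof -
    obtain z1 z2 z3 w1 w2 w3
      where z: "m5_coords X = (z1, z2, z3)" and w: "m5_coords (J X) = (w1, w2, w3)"
      by (metis prod_cases3)
    show ?thesis
      using coords[OF z] coords[OF w] generic(2)[OF z w]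
      by (auto simp: m5_coords_def complex_eq_iff)
  qed
  have K2: "?K X $ 2 = X $ 3" for X
    using \<Psi>[of "inv \<Psi> X"] aut
    by (simp add: lie_automorphism_def bij_is_surj surj_f_inv_f)
  have K: "complex_structure m5_bracket ?K"
    using eq by (simp add: equivalent_cs_def)
  then have "?K (?K X) = - X" for X
    by (simp add: complex_structure_def)
  \<comment> \<open>Apply \<open>K2\<close> to \<open>?K X\<close>: row 3 is forced by row 2 and the
    square of \<open>?K\<close>.\<close>
  then have "?K X $ 3 = - X $ 2" for X
    by (metis K2 vector_uminus_component)
  then show ?thesis
    using equivalent_cs_m5_J[OF K K2] equivalent_cs_trans[OF eq] by blast
qed

end
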